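(* Let $R$ be an associative ring (not necessarily unital). For $i=1,2$ let $a_i,b_i,c_i\in R$ and suppose that $a_i$ is annihilator $(b_i,c_i)$-invertible with annihilator $(b_i,c_i)$-inverse $x_i\in R$. Then for any $y\in R^1$: (i) $ya_1x_1=a_2x_2y$ if and only if $ya_1b_1\in a_2x_2R$ and $c_2y\in Rx_1$. (ii) $yx_1a_1=x_2a_2y$ if and only if $yb_1\in x_2R$ and $c_2a_2y\in Rx_1a_1$. (iii) $ya_1x_1=x_2a_2y$ if and only if $ya_1b_1\in x_2R$ and $c_2a_2y\in Rx_1$. (iv) $yx_1a_1=a_2x_2y$ if and only if $yb_1\in a_2x_2R$ and $c_2y\in Rx_1a_1$.
   Context: For $u\in R$ write ${}^{\circ}u=\{r\in R: ru=0\}$, $u^{\circ}=\{r\in R: ur=0\}$, $uR=\{ur:r\in R\}$, $Ru=\{ru:r\in R\}$. For $a,b,c\in R$, an element $x\in R$ is an annihilator $(b,c)$-inverse of $a$ if $xax=x$, $xab=b$, $cax=c$, ${}^{\circ}b\subseteq{}^{\circ}x$, and $c^{\circ}\subseteq x^{\circ}$; such $x$ is unique when it exists, and $a$ is then called annihilator $(b,c)$-invertible. $R^1$ denotes the multiplicative monoid equal to $R$ if $R$ has an identity element and to $R\cup\{1\}$ (with an identity $1$ adjoined) otherwise. *)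

theory Defs
  imports Main
begin

text \<open>
  The ambient ring is a type of class \<^class>\<open>ring\<close>, which does not
  require an identity element.
\<close>

definition left_annihilator :: "'a::ring \<Rightarrow> 'a set" where
  "left_annihilator u = {r. r * u = 0}"

definition right_annihilator :: "'a::ring \<Rightarrow> 'a set" where
  "right_annihilator u = {r. u * r = 0}"

definition right_multiples :: "'a::ring \<Rightarrow> 'a set" where
  "right_multiples u = {u * r |r. True}"

definition left_multiples :: "'a::ring \<Rightarrow> 'a set" where
  "left_multiples u = {r * u |r. True}"

definition annihilator_inverse :: "'a::ring \<Rightarrow> 'a \<Rightarrow> 'a \<Rightarrow> 'a \<Rightarrow> bool" where
  "annihilator_inverse a b c x \<longleftrightarrow>
     x * a * x = x \<and> x * a * b = b \<and> c * a * x = c \<and>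
     left_annihilator b \<subseteq> left_annihilator x \<and>
     right_annihilator c \<subseteq> right_annihilator x"

definition is_identity :: "'a::ring \<Rightarrow> bool" where
  "is_identity e \<longleftrightarrow> (\<forall>r. e * r = r \<and> r * e = r)"

lemma is_identity_unique: "is_identity e \<Longrightarrow> is_identity e' \<Longrightarrow> e = e'"
  by (metis is_identity_def)

text \<open>
  The monoid \<open>R\<^sup>1\<close>: the elements of \<open>R\<close> are the values \<^const>\<open>Some\<close> \<open>r\<close>;
  \<^const>\<open>None\<close> is the adjoined identity and belongs to the type only if \<open>R\<close>
  has no identity of its own.
\<close>

typedef (overloaded) 'a monoid1 =
  "{z :: 'a::ring option. z = None \<longrightarrow> (\<nexists>e::'a. is_identity e)}"
  by (rule exI[of _ "Some 0"]) simp

setup_lifting type_definition_monoid1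

lift_definition emb :: "'a::ring \<Rightarrow> 'a monoid1" is Some
  by simp

fun mult1 :: "'a::ring option \<Rightarrow> 'a option \<Rightarrow> 'a option" where
  "mult1 None z = z"
| "mult1 (Some r) None = Some r"
| "mult1 (Some r) (Some s) = Some (r * s)"

instantiation monoid1 :: (ring) monoid_mult
begin

lift_definition times_monoid1 :: "'a monoid1 \<Rightarrow> 'a monoid1 \<Rightarrow> 'a monoid1" is mult1
  by (metis mult1.elims option.distinct(1))

lift_definition one_monoid1 :: "'a monoid1" is
  "if \<exists>e::'a. is_identity e then Some (THE e. is_identity e) else None"
  by (simp split: if_splits)

instance
proof
  have the_id: "is_identity (THE e::'a. is_identity e)" if "\<exists>e::'a. is_identity e"
    using that is_identity_unique by (metis the_equality)
  fix x y z :: "'a monoid1"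
  show "x * y * z = x * (y * z)"
  proof transfer
    fix x y z :: "'a option"
    show "mult1 (mult1 x y) z = mult1 x (mult1 y z)"
      by (cases x; cases y; cases z) (simp_all add: mult.assoc)
  qed
  show "1 * x = x"
  proof transfer
    fix x :: "'a option"
    assume "x = None \<longrightarrow> (\<nexists>e::'a. is_identity e)"
    then show "mult1 (if \<exists>e::'a. is_identity e then Some (THE e. is_identity e) else None) x = x"
      using the_id by (cases x) (auto simp: is_identity_def[of "THE e. is_identity e"])
  qed
  show "x * 1 = x"
  proof transfer
    fix x :: "'a option"
    assume "x = None \<longrightarrow> (\<nexists>e::'a. is_identity e)"
    then show "mult1 x (if \<exists>e::'a. is_identity e then Some (THE e. is_identity e) else None) = x"
      using the_id by (cases x) (auto simp: is_identity_def[of "THE e. is_identity e"])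
  qed
qed

end

lemma emb_inject [simp]: "emb r = emb s \<longleftrightarrow> r = s"
  by transfer simp

lemma emb_mult: "emb (r * s) = emb r * emb s"
  by transfer simp

lemma monoid1_cases: "(\<exists>r. y = emb r) \<or> y = 1"
  for y :: "'a::ring monoid1"
  by transfer auto

lemma surj_emb_iff: "surj (emb :: 'a::ring \<Rightarrow> 'a monoid1) \<longleftrightarrow> (\<exists>e::'a. is_identity e)"
proof
  assume "surj (emb :: 'a \<Rightarrow> 'a monoid1)"
  then obtain e :: 'a where e: "1 = emb e"
    by (metis surjD)
  have "emb (e * r) = emb r \<and> emb (r * e) = emb r" for r :: 'a
    by (simp only: emb_mult e[symmetric] mult_1_left mult_1_right)
  then show "\<exists>e::'a. is_identity e"
    unfolding is_identity_def by auto
next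
  assume "\<exists>e::'a. is_identity e"
  then have "\<exists>r. y = emb r" for y :: "'a monoid1"
    by transfer auto
  then show "surj (emb :: 'a \<Rightarrow> 'a monoid1)"
    by (metis surjI surj_def)
qed

end

theory Submission
  imports Defs
begin

text \<open>
  The elements \<open>a x\<close> and \<open>x a\<close> formed from an annihilator inverse are idempotent. For idempotents
  \<open>p\<close>, \<open>q\<close> of a semigroup, \<open>y p = q y\<close> splits into the two absorption laws \<open>q y p = y p\<close> and
  \<open>q y p = q y\<close> (\<open>intertwines_idempotents_iff\<close>). Each of these laws is one of the two membership
  conditions in disguise. Indeed \<open>x R = x a R\<close> and \<open>R x = R a x\<close>, so all the one-sided ideals
  in question are generated by idempotents, and lying in \<open>q R\<close> or \<open>R p\<close> means being fixed
  by \<open>q\<close> or \<open>p\<close>. Finally, the equations \<open>x a b = b\<close> and \<open>c a x = c\<close> together with the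
  annihilator inclusions allow \<open>b\<close> to be exchanged for \<open>x\<^sub>1\<close> and \<open>c\<close> for \<open>x\<^sub>2\<close> in these
  fixed-point equations (\<open>left_fixed_iff\<close>, \<open>right_fixed_iff\<close>).

  The one delicate point is that \<open>y\<close> may be the adjoined identity, so that differences such as
  \<open>y - q y\<close> need not make sense; the annihilator inclusions are therefore applied only after
  inserting \<open>x a\<close> or \<open>a x\<close>, which moves everything into the ideal \<open>R\<close> of \<open>R\<^sup>1\<close>.
\<close>

lemma mult_emb_in_range: "\<exists>r. z * emb u = emb r"
  using monoid1_cases[of z] by (metis emb_mult mult_1_left)

lemma emb_mult_in_range: "\<exists>r. emb u * z = emb r"
  using monoid1_cases[of z] by (metis emb_mult mult_1_right)

text \<open>The hypotheses make \<open>q\<close> an idempotent with \<open>q R = u R\<close>, and \<open>q R\<close> consists of the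
  elements fixed by left multiplication by \<open>q\<close>.\<close>

lemma in_right_multiples_iff_fixed:
  assumes "q = u * t" and "q * u = u"
  shows "z * emb b \<in> emb ` right_multiples u \<longleftrightarrow> emb q * (z * emb b) = z * emb b"
proof -
  obtain r where r: "z * emb b = emb r"
    using mult_emb_in_range by blast
  have "r \<in> right_multiples u \<longleftrightarrow> q * r = r"
    unfolding right_multiples_def using assms by (auto simp: mult.assoc) (metis mult.assoc)+
  then show ?thesis
    unfolding r by (auto simp flip: emb_mult)
qed

lemma in_left_multiples_iff_fixed:
  assumes "p = t * u" and "u * p = u"
  shows "emb c * z \<in> emb ` left_multiples u \<longleftrightarrow> emb c * z * emb p = emb c * z"
proof -
  obtain r where r: "emb c * z = emb r"
    using emb_mult_in_range by blast
  have "r \<in> left_multiples u \<longleftrightarrow> r * p = r"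
    unfolding left_multiples_def using assms by (auto simp: mult.assoc) (metis mult.assoc)+
  then show ?thesis
    unfolding r by (auto simp flip: emb_mult)
qed

lemma annihilator_inverse_right_cancel:
  assumes "annihilator_inverse a b c x" and "u * b = v * b"
  shows "u * x = v * x"
proof -
  have "u - v \<in> left_annihilator b"
    using assms(2) by (simp add: left_annihilator_def left_diff_distrib)
  then have "u - v \<in> left_annihilator x"
    using assms(1) by (auto simp: annihilator_inverse_def)
  then show ?thesis
    by (simp add: left_annihilator_def left_diff_distrib)
qed

lemma annihilator_inverse_left_cancel:
  assumes "annihilator_inverse a b c x" and "c * u = c * v"
  shows "x * u = x * v"
proof -
  have "u - v \<in> right_annihilator c"
    using assms(2) by (simp add: right_annihilator_def right_diff_distrib)
  then have "u - v \<in> right_annihilator x"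
    using assms(1) by (auto simp: annihilator_inverse_def)
  then show ?thesis
    by (simp add: right_annihilator_def right_diff_distrib)
qed

text \<open>
  Since \<open>b = x (a b)\<close>, being fixed passes from \<open>z x\<close> to \<open>z b\<close>. Conversely, \<open>q (z x a)\<close> and
  \<open>z x a\<close> are genuine ring elements that agree after multiplication by \<open>b\<close>, hence also
  after multiplication by \<open>x = x a x\<close>.
\<close>

lemma left_fixed_iff:
  assumes inv: "annihilator_inverse a b c x"
  shows "emb q * (z * emb b) = z * emb b \<longleftrightarrow> emb q * (z * emb x) = z * emb x"
proof -
  have xab: "emb x * (emb a * emb b) = emb b" and xax: "emb x * (emb a * emb x) = emb x"
    using inv by (simp_all add: annihilator_inverse_def mult.assoc flip: emb_mult)
  obtain u where u: "z * emb x * emb a = emb u"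
    using mult_emb_in_range by blast
  have ub: "emb u * emb b = z * emb b" and ux: "emb u * emb x = z * emb x"
    by (simp_all add: xab xax mult.assoc flip: u)
  show ?thesis
  proof
    assume "emb q * (z * emb b) = z * emb b"
    then have "q * u * b = u * b"
      by (simp add: mult.assoc emb_mult flip: ub emb_inject)
    then have "q * u * x = u * x"
      using inv by (rule annihilator_inverse_right_cancel[rotated])
    then show "emb q * (z * emb x) = z * emb x"
      by (simp add: mult.assoc flip: ux emb_mult)
  next
    assume "emb q * (z * emb x) = z * emb x"
    then have "emb q * (z * emb x) * (emb a * emb b) = z * emb x * (emb a * emb b)"
      by simp
    then show "emb q * (z * emb b) = z * emb b"
      by (simp add: mult.assoc xab)
  qed
qed

text \<open>The mirror image, with \<open>a x z\<close> as the genuine ring element and \<open>c = (c a) x\<close>.\<close>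

lemma right_fixed_iff:
  assumes inv: "annihilator_inverse a b c x"
  shows "emb c * z * emb p = emb c * z \<longleftrightarrow> emb x * z * emb p = emb x * z"
proof -
  have cax: "emb c * emb a * emb x = emb c" and xax: "emb x * emb a * emb x = emb x"
    using inv by (simp_all add: annihilator_inverse_def flip: emb_mult)
  obtain u where u: "emb a * (emb x * z) = emb u"
    using emb_mult_in_range by blast
  have cu: "emb c * emb u = emb c * z" and xu: "emb x * emb u = emb x * z"
    by (simp_all add: cax xax flip: u mult.assoc)
  show ?thesis
  proof
    assume "emb c * z * emb p = emb c * z"
    then have "c * (u * p) = c * u"
      by (simp add: emb_mult flip: cu emb_inject mult.assoc)
    then have "x * (u * p) = x * u"
      using inv by (rule annihilator_inverse_left_cancel[rotated])
    then show "emb x * z * emb p = emb x * z"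
      by (simp add: mult.assoc flip: xu emb_mult)
  next
    assume "emb x * z * emb p = emb x * z"
    then have "emb c * emb a * (emb x * z * emb p) = emb c * emb a * (emb x * z)"
      by simp
    then show "emb c * z * emb p = emb c * z"
      by (simp add: cax flip: mult.assoc)
  qed
qed

lemma intertwines_idempotents_iff:
  fixes p q y :: "'a::semigroup_mult"
  assumes "p * p = p" and "q * q = q"
  shows "y * p = q * y \<longleftrightarrow> q * (y * p) = y * p \<and> q * y * p = q * y"
  using assms by (metis mult.assoc)

text \<open>
  The absorption laws involve the idempotents \<open>x a\<close> and \<open>a x\<close>, while exchanging \<open>b\<close> or
  \<open>c\<close> produces the bare factor \<open>x\<close>. Multiplying by \<open>a\<close> supplies the missing factor, and
  multiplying by a further \<open>x\<close> removes it again.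
\<close>

lemma left_fixed_extend_iff:
  fixes q z x a :: "'a::semigroup_mult"
  assumes "x * (a * x) = x"
  shows "q * (z * (x * a)) = z * (x * a) \<longleftrightarrow> q * (z * x) = z * x"
  using assms by (metis mult.assoc)

lemma right_fixed_extend_iff:
  fixes p z x a :: "'a::semigroup_mult"
  assumes "x * (a * x) = x"
  shows "a * x * z * p = a * x * z \<longleftrightarrow> x * z * p = x * z"
  using assms by (metis mult.assoc)

theorem theorem3p8:
  fixes a1 b1 c1 x1 a2 b2 c2 x2 :: "'a::ring"
    and y :: "'a monoid1"
  assumes "annihilator_inverse a1 b1 c1 x1"
    and "annihilator_inverse a2 b2 c2 x2"
  shows "(y * emb a1 * emb x1 = emb a2 * emb x2 * y \<longleftrightarrow>
            y * emb a1 * emb b1 \<in> emb ` right_multiples (a2 * x2) \<and>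
            emb c2 * y \<in> emb ` left_multiples x1) \<and>
         (y * emb x1 * emb a1 = emb x2 * emb a2 * y \<longleftrightarrow>
            y * emb b1 \<in> emb ` right_multiples x2 \<and>
            emb c2 * emb a2 * y \<in> emb ` left_multiples (x1 * a1)) \<and>
         (y * emb a1 * emb x1 = emb x2 * emb a2 * y \<longleftrightarrow>
            y * emb a1 * emb b1 \<in> emb ` right_multiples x2 \<and>
            emb c2 * emb a2 * y \<in> emb ` left_multiples x1) \<and>
         (y * emb x1 * emb a1 = emb a2 * emb x2 * y \<longleftrightarrow>
            y * emb b1 \<in> emb ` right_multiples (a2 * x2) \<and>
            emb c2 * y \<in> emb ` left_multiples (x1 * a1))"
proof -
  have xax1: "x1 * (a1 * x1) = x1" and xax2: "x2 * (a2 * x2) = x2"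
    using assms by (simp_all add: annihilator_inverse_def mult.assoc)
  have embx1: "emb x1 * (emb a1 * emb x1) = emb x1"
    and embx2: "emb x2 * (emb a2 * emb x2) = emb x2"
    by (simp_all add: xax1 xax2 flip: emb_mult)
  have idem: "emb (a1 * x1) * emb (a1 * x1) = emb (a1 * x1)"
    "emb (x1 * a1) * emb (x1 * a1) = emb (x1 * a1)"
    "emb (a2 * x2) * emb (a2 * x2) = emb (a2 * x2)"
    "emb (x2 * a2) * emb (x2 * a2) = emb (x2 * a2)"
    by (metis xax1 xax2 emb_mult mult.assoc)+

  have right_ax: "z * emb b1 \<in> emb ` right_multiples (a2 * x2) \<longleftrightarrow>
      emb (a2 * x2) * (z * emb x1) = z * emb x1" for z
    using in_right_multiples_iff_fixed[of "a2 * x2" "a2 * x2" "a2 * x2"]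
      left_fixed_iff[OF assms(1)] by (simp add: mult.assoc xax2)
  have right_x: "z * emb b1 \<in> emb ` right_multiples x2 \<longleftrightarrow>
      emb (x2 * a2) * (z * emb x1) = z * emb x1" for z
    using in_right_multiples_iff_fixed[of "x2 * a2" x2 a2]
      left_fixed_iff[OF assms(1)] by (simp add: mult.assoc xax2)
  have left_x: "emb c2 * z \<in> emb ` left_multiples x1 \<longleftrightarrow>
      emb x2 * z * emb (a1 * x1) = emb x2 * z" for z
    using in_left_multiples_iff_fixed[of "a1 * x1" a1 x1]
      right_fixed_iff[OF assms(2)] by (simp add: xax1)
  have left_xa: "emb c2 * z \<in> emb ` left_multiples (x1 * a1) \<longleftrightarrow>
      emb x2 * z * emb (x1 * a1) = emb x2 * z" for z
  proof -
    have "x1 * a1 * (x1 * a1) = x1 * a1"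
      by (metis xax1 mult.assoc)
    then show ?thesis
      using in_left_multiples_iff_fixed[of "x1 * a1" "x1 * a1" "x1 * a1"]
        right_fixed_iff[OF assms(2)] by simp
  qed

  have i: "y * emb (a1 * x1) = emb (a2 * x2) * y \<longleftrightarrow>
      y * emb a1 * emb b1 \<in> emb ` right_multiples (a2 * x2) \<and>
      emb c2 * y \<in> emb ` left_multiples x1"
    unfolding intertwines_idempotents_iff[OF idem(1,3)] right_ax left_x
    using right_fixed_extend_iff[OF embx2, of y "emb (a1 * x1)"]
    by (simp add: emb_mult mult.assoc)
  have ii: "y * emb (x1 * a1) = emb (x2 * a2) * y \<longleftrightarrow>
      y * emb b1 \<in> emb ` right_multiples x2 \<and>
      emb c2 * (emb a2 * y) \<in> emb ` left_multiples (x1 * a1)"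
    unfolding intertwines_idempotents_iff[OF idem(2,4)] right_x left_xa
    using left_fixed_extend_iff[OF embx1, of "emb (x2 * a2)" y]
    by (simp add: emb_mult mult.assoc)
  have iii: "y * emb (a1 * x1) = emb (x2 * a2) * y \<longleftrightarrow>
      y * emb a1 * emb b1 \<in> emb ` right_multiples x2 \<and>
      emb c2 * (emb a2 * y) \<in> emb ` left_multiples x1"
    unfolding intertwines_idempotents_iff[OF idem(1,4)] right_x left_x
    by (simp add: emb_mult mult.assoc)
  have iv: "y * emb (x1 * a1) = emb (a2 * x2) * y \<longleftrightarrow>
      y * emb b1 \<in> emb ` right_multiples (a2 * x2) \<and>
      emb c2 * y \<in> emb ` left_multiples (x1 * a1)"
    unfolding intertwines_idempotents_iff[OF idem(2,3)] right_ax left_xa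
    using left_fixed_extend_iff[OF embx1, of "emb (a2 * x2)" y]
      right_fixed_extend_iff[OF embx2, of y "emb (x1 * a1)"]
    by (simp add: emb_mult mult.assoc)
  show ?thesis
    using i ii iii iv by (simp add: emb_mult mult.assoc)
qed

end
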